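(* Let $T$ be a finite nonempty set of integers, all $>1$, let $M=\max_{t\in T}(t-1)$, and let $f_n$ ($n\ge 2M+1$) be the quadratic rotation symmetric Boolean function $$f_n(x_1,\dots,x_n)=\sum_{r=1}^{n}\sum_{t\in T}x_rx_{r+t-1}$$ (subscripts modulo $n$, sum in $\mathbb F_2$), with Hamming weight $\operatorname{wt}(f_n)$. Let $\mathcal R(f)$ be the rules matrix of $T$ (a square matrix of size $2^M+1$ having $2$ as a characteristic root), and let $\eta_1,\dots,\eta_{2^M}$ be the roots in $\mathbb C$ of $\det(xI-\mathcal R(f))$ other than one occurrence of the distinguished root $2$, counted with their full algebraic multiplicities. Write $\det(xI-\mathcal R(f))=\sum_{k=0}^{2^M+1}p_kx^k$. Then there is exactly one sequence $(w_n)_{n\ge1}$ with $$\sum_{k=0}^{2^M+1}p_k\,w_{n+k}=0\quad\text{for all } n\ge 1,\qquad w_n=\operatorname{wt}(f_n)\quad\text{for all } n\ge 2M+1$$ (that is, the sequence obtained by extending the weight recursion backwards from $n=2M+1$ to $n=1$), and it satisfies $$w_n=2^{n-1}-\frac12\left(\eta_1^n+\eta_2^n+\cdots+\eta_{2^M}^n\right)\qquad\text{for all } n\ge1.$$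
   Context: The Hamming weight $\operatorname{wt}(g)$ of a Boolean function $g:\mathbb F_2^n\to\mathbb F_2$ is $\#\{x\in\mathbb F_2^n: g(x)=1\}$. Definition of the rules matrix. Let $\mathcal S=\prod_{t\in T}\mathbb F_2^{t-1}$. Write $u\in\mathcal S$ as $u=(u^{(t)})_{t\in T}$ with $u^{(t)}=(u^{(t)}_0,\dots,u^{(t)}_{t-2})$. For $\varepsilon\in\mathbb F_2$ define $\Sigma_\varepsilon(u)\in\mathcal S$ by $\Sigma_\varepsilon(u)^{(t)}=(u^{(t)}_1,\dots,u^{(t)}_{t-2},\varepsilon)$ for each $t\in T$. Let $W$ be the matrix with rows and columns indexed by $\mathcal S$ (rows are new states, columns are old states) with $$W_{\Sigma_\varepsilon(u),u}=(-1)^{\varepsilon\sum_{t\in T}u^{(t)}_0}\qquad(\varepsilon\in\mathbb F_2,\ u\in\mathcal S)$$ and all other entries zero. The expanded rules matrix is obtained from $W$ by adjoining one final row and one final column: the final column is zero except for its last entry (in the final row), which is $2$; the final row has, in the column indexed by $u\in\mathcal S$, the entry $1$ if $\sum_{t\in T}u^{(t)}_0=1$ in $\mathbb F_2$ and $0$ otherwise. The rules matrix $\mathcal R(f)$ is obtained from the expanded rules matrix by repeatedly deleting a zero row together with the column of the same index, until no zero row remains. It is well defined up to a simultaneous permutation of rows and columns. *)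

theory Defs
  imports
    "HOL-Library.FuncSet"
    "HOL-Library.Multiset"
    "HOL-Library.Z2"
    "HOL-Computational_Algebra.Fundamental_Theorem_Algebra"
    "Jordan_Normal_Form.Char_Poly"
begin

text \<open>
  The field with two elements is \<^typ>\<open>bit\<close> (theory Z2).  A point of \<open>F\<^sub>2\<^sup>n\<close> is an
  extensional function on \<open>{1..n}\<close>.
\<close>

definition hamming_weight :: "nat \<Rightarrow> ((nat \<Rightarrow> bit) \<Rightarrow> bit) \<Rightarrow> nat" where
  "hamming_weight n g = card {x \<in> {1..n} \<rightarrow>\<^sub>E UNIV. g x = 1}"

text \<open>The representative in \<open>{1..n}\<close> of the subscript \<open>k \<ge> 1\<close> modulo \<open>n\<close>.\<close>

definition cyc :: "nat \<Rightarrow> nat \<Rightarrow> nat" where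
  "cyc n k = (k - 1) mod n + 1"

definition rot_quad :: "nat set \<Rightarrow> nat \<Rightarrow> (nat \<Rightarrow> bit) \<Rightarrow> bit" where
  "rot_quad T n x = (\<Sum>r = 1..n. \<Sum>t\<in>T. x r * x (cyc n (r + t - 1)))"

type_synonym state = "nat \<Rightarrow> nat \<Rightarrow> bit"

text \<open>\<open>u t i\<close> stands for \<open>u\<^sup>(\<^sup>t\<^sup>)\<^sub>i\<close>, where \<open>t \<in> T\<close> and \<open>0 \<le> i \<le> t - 2\<close>.\<close>

definition states :: "nat set \<Rightarrow> state set" where
  "states T = (\<Pi>\<^sub>E t\<in>T. {..<t - 1} \<rightarrow>\<^sub>E UNIV)"

definition shift :: "nat set \<Rightarrow> bit \<Rightarrow> state \<Rightarrow> state" where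
  "shift T \<epsilon> u = (\<lambda>t\<in>T. \<lambda>i\<in>{..<t - 1}. if i = t - 2 then \<epsilon> else u t (i + 1))"

definition head_sum :: "nat set \<Rightarrow> state \<Rightarrow> bit" where
  "head_sum T u = (\<Sum>t\<in>T. u t 0)"

definition bit_sign :: "bit \<Rightarrow> complex" where
  "bit_sign b = (if b = 1 then -1 else 1)"

text \<open>
  Row \<open>v\<close> (new state), column \<open>u\<close> (old state).  At most one of the two summands is nonzero,
  since \<open>shift T 0 u \<noteq> shift T 1 u\<close>; see \<open>transfer_entry_shift\<close> below.
\<close>

definition transfer_entry :: "nat set \<Rightarrow> state \<Rightarrow> state \<Rightarrow> complex" where
  "transfer_entry T v u =
     (\<Sum>\<epsilon>\<in>{0, 1}. if v = shift T \<epsilon> u then bit_sign (\<epsilon> * head_sum T u) else 0)"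

text \<open>The expanded rules matrix; \<^const>\<open>None\<close> is the index of the final row and column.\<close>

fun expanded_entry :: "nat set \<Rightarrow> state option \<Rightarrow> state option \<Rightarrow> complex" where
  "expanded_entry T (Some v) (Some u) = transfer_entry T v u"
| "expanded_entry T (Some v) None = 0"
| "expanded_entry T None (Some u) = (if head_sum T u = 1 then 1 else 0)"
| "expanded_entry T None None = 2"

definition expanded_indices :: "nat set \<Rightarrow> state option set" where
  "expanded_indices T = insert None (Some ` states T)"

text \<open>
  \<open>prunes_to A I J\<close>: starting from the matrix \<open>A\<close> on the index set \<open>I\<close>, repeatedly deleting
  the row and the column of an index whose (remaining) row is zero can end with the index set
  \<open>J\<close>, on which there is no zero row.
\<close>

inductive prunes_to :: "('i \<Rightarrow> 'i \<Rightarrow> 'a :: zero) \<Rightarrow> 'i set \<Rightarrow> 'i set \<Rightarrow> bool" for A where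
  stop: "(\<And>i. i \<in> I \<Longrightarrow> \<exists>j\<in>I. A i j \<noteq> 0) \<Longrightarrow> prunes_to A I I"
| delete: "i \<in> I \<Longrightarrow> (\<And>j. j \<in> I \<Longrightarrow> A i j = 0) \<Longrightarrow> prunes_to A (I - {i}) J \<Longrightarrow> prunes_to A I J"

text \<open>
  The rules matrix depends on the choice of an enumeration \<open>is\<close> of the remaining indices, so it
  is given as a predicate satisfied by all of its versions.
\<close>

definition is_rules_matrix :: "nat set \<Rightarrow> complex mat \<Rightarrow> bool" where
  "is_rules_matrix T R \<longleftrightarrow>
     (\<exists>is. distinct is \<and>
        prunes_to (expanded_entry T) (expanded_indices T) (set is) \<and>
        R = mat (length is) (length is) (\<lambda>(a, b). expanded_entry T (is ! a) (is ! b)))"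

text \<open>
  \<open>w\<close> satisfies, from index \<open>1\<close> on, the recursion whose characteristic polynomial is that of \<open>R\<close>,
  and agrees with the weights of the functions \<open>f\<^sub>n\<close> for \<open>n \<ge> 2M + 1\<close>.  Sequences
  \<open>(w\<^sub>n)\<^sub>n\<^sub>\<ge>\<^sub>1\<close> are extensional functions on \<open>{1..}\<close>.
\<close>

definition extends_weights :: "nat set \<Rightarrow> nat \<Rightarrow> complex mat \<Rightarrow> (nat \<Rightarrow> complex) \<Rightarrow> bool" where
  "extends_weights T M R w \<longleftrightarrow>
     w \<in> {1..} \<rightarrow>\<^sub>E UNIV \<and>
     (\<forall>n\<ge>1. (\<Sum>k = 0..2 ^ M + 1. coeff (char_poly R) k * w (n + k)) = 0) \<and>
     (\<forall>n\<ge>2 * M + 1. w n = of_nat (hamming_weight n (rot_quad T n)))"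

lemma shift_inj:
  assumes "T \<noteq> {}" "\<And>t. t \<in> T \<Longrightarrow> 1 < t" "shift T \<epsilon> u = shift T \<delta> u"
  shows "\<epsilon> = \<delta>"
proof -
  obtain t where t: "t \<in> T" "1 < t" using assms by blast
  have "shift T \<epsilon> u t (t - 2) = shift T \<delta> u t (t - 2)" using assms(3) by simp
  with t show ?thesis by (simp add: shift_def split: if_splits)
qed

lemma transfer_entry_shift:
  assumes "T \<noteq> {}" "\<And>t. t \<in> T \<Longrightarrow> 1 < t"
  shows "transfer_entry T (shift T \<epsilon> u) u = bit_sign (\<epsilon> * head_sum T u)"
proof -
  have "shift T 0 u \<noteq> shift T 1 u"
    using shift_inj[OF assms, of 0 u 1] by auto
  then show ?thesis by (cases \<epsilon>) (auto simp: transfer_entry_def)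
qed

lemma transfer_entry_eq_0:
  "(\<And>\<epsilon>. v \<noteq> shift T \<epsilon> u) \<Longrightarrow> transfer_entry T v u = 0"
  by (simp add: transfer_entry_def)

lemma prunes_to_exists:
  assumes "finite I"
  shows "\<exists>J\<subseteq>I. prunes_to A I J"
  using assms
proof (induction I rule: finite_psubset_induct)
  case (psubset I)
  show ?case
  proof (cases "\<exists>i\<in>I. \<forall>j\<in>I. A i j = 0")
    case True
    then obtain i where i: "i \<in> I" "\<forall>j\<in>I. A i j = 0" by blast
    then have "I - {i} \<subset> I" by blast
    from psubset.IH[OF this] obtain J where J: "J \<subseteq> I - {i}" "prunes_to A (I - {i}) J"
      by auto
    from i J(2) have "prunes_to A I J" by (auto intro: prunes_to.delete)
    with J(1) show ?thesis by auto
  next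
    case False
    then have "prunes_to A I I" by (intro prunes_to.stop) auto
    then show ?thesis by auto
  qed
qed

lemma finite_UNIV_bit: "finite (UNIV :: bit set)"
proof -
  have "(UNIV :: bit set) = {0, 1}" by (auto intro: bit.exhaust)
  then show ?thesis by (rule ssubst) simp
qed

lemma is_rules_matrix_exists:
  assumes "finite T"
  shows "\<exists>R. is_rules_matrix T R"
proof -
  have fin: "finite (expanded_indices T)"
    using assms finite_UNIV_bit by (auto simp: expanded_indices_def states_def intro!: finite_PiE)
  obtain J where J: "J \<subseteq> expanded_indices T"
    "prunes_to (expanded_entry T) (expanded_indices T) J"
    using prunes_to_exists[OF fin] by blast
  from J(1) fin have "finite J" by (rule finite_subset)
  then obtain xs where xs: "set xs = J" "distinct xs"
    using finite_distinct_list by auto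
  show ?thesis
    unfolding is_rules_matrix_def by (rule exI, rule exI[of _ xs]) (simp add: xs J(2))
qed

end

theory Submission
  imports Defs "Jordan_Normal_Form.Schur_Decomposition"
begin

text \<open>
  A state with arbitrarily long chains of predecessors records the last \<open>M\<close> inputs of a bit sequence,
  so pruning leaves exactly \<open>2\<^sup>M\<close> such states and the final index.  For every \<open>n \<ge> 1\<close> a closed walk of
  length \<open>n\<close> through these states corresponds to a point \<open>x\<close> of \<open>F\<^sub>2\<^sup>n\<close>, its states being read off the
  \<open>n\<close>-periodic extension of \<open>x\<close>, and the product of the matrix entries along it is \<open>(-1)\<^bsup>f(x)\<^esup>\<close> with
  \<open>f = f\<^sub>n\<close>.  Hence the trace of \<open>R\<^sup>n\<close>, which is the sum of the \<open>n\<close>-th powers of all characteristic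
  roots, equals \<open>2\<^sup>n + (2\<^sup>n - 2 wt(f\<^sub>n))\<close>; this is the formula, and it makes the weights satisfy the
  recursion from \<open>n = 1\<close> on.  The matrix is nonsingular, so \<open>p\<^sub>0 \<noteq> 0\<close> and the backward extension is
  unique.
\<close>

section \<open>Traces of matrix powers and power sums of characteristic roots\<close>

lemma index_mult_mat_sum:
  assumes "A \<in> carrier_mat n n" "B \<in> carrier_mat n n" "i < n" "j < n"
  shows "(A * B) $$ (i, j) = (\<Sum>k<n. A $$ (i, k) * B $$ (k, j))"
  using assms by (auto simp: scalar_prod_def atLeast0LessThan intro!: sum.cong)

lemma sum_diag_mult_commute:
  fixes A :: "'a :: comm_semiring_0 mat"
  assumes "A \<in> carrier_mat n n" "B \<in> carrier_mat n n"
  shows "(\<Sum>i<n. (A * B) $$ (i, i)) = (\<Sum>i<n. (B * A) $$ (i, i))"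
proof -
  have "(\<Sum>i<n. (A * B) $$ (i, i)) = (\<Sum>i<n. \<Sum>k<n. A $$ (i, k) * B $$ (k, i))"
    using assms by (intro sum.cong refl index_mult_mat_sum) auto
  also have "\<dots> = (\<Sum>k<n. \<Sum>i<n. B $$ (k, i) * A $$ (i, k))"
    by (subst sum.swap) (simp add: mult.commute)
  also have "\<dots> = (\<Sum>k<n. (B * A) $$ (k, k))"
    using assms by (intro sum.cong refl index_mult_mat_sum[symmetric]) auto
  finally show ?thesis .
qed

text \<open>In the sum over \<open>l\<close>, a term with \<open>l > j\<close> has a zero right
  factor; for \<open>l \<le> j \<le> i\<close> the induction hypothesis makes the left factor zero
  unless \<open>l = i\<close>. So only \<open>l = j = i\<close> can contribute.\<close>

lemma upper_triangular_power:
  fixes A :: "'a :: comm_semiring_1 mat"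
  assumes A: "A \<in> carrier_mat n n" and ut: "upper_triangular A"
  shows "i < n \<Longrightarrow> j \<le> i \<Longrightarrow> (A ^\<^sub>m k) $$ (i, j) = (if j = i then (A $$ (i, i)) ^ k else 0)"
proof (induction k arbitrary: i j)
  case 0
  then show ?case using A by auto
next
  case (Suc k)
  have "(A ^\<^sub>m Suc k) $$ (i, j) = (\<Sum>l<n. (A ^\<^sub>m k) $$ (i, l) * A $$ (l, j))"
    using A Suc.prems by (simp only: pow_mat.simps) (intro index_mult_mat_sum, auto)
  also have "\<dots> = (\<Sum>l<n. if l = j then (if j = i then (A $$ (i, i)) ^ Suc k else 0) else 0)"
  proof (intro sum.cong refl)
    fix l assume l: "l \<in> {..<n}"
    consider "j < l" | "l \<le> j" by linarith
    then show "(A ^\<^sub>m k) $$ (i, l) * A $$ (l, j)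
        = (if l = j then (if j = i then (A $$ (i, i)) ^ Suc k else 0) else 0)"
    proof cases
      case 1
      then show ?thesis using ut A l unfolding upper_triangular_def by auto
    next
      case 2
      then show ?thesis using Suc.IH[of i l] Suc.prems by (auto simp: mult.commute)
    qed
  qed
  also have "\<dots> = (if j = i then (A $$ (i, i)) ^ Suc k else 0)"
    using Suc.prems by (auto simp: sum.delta)
  finally show ?case .
qed

text \<open>Schur triangularization: \<open>A\<close> is similar to an upper triangular
  \<open>B\<close> whose diagonal lists the characteristic roots with multiplicity, and the trace of
  a power is invariant under similarity.\<close>

lemma sum_proots_char_poly_power:
  fixes A :: "complex mat"
  assumes A: "A \<in> carrier_mat n n"
  shows "(\<Sum>\<eta>\<in>#proots (char_poly A). \<eta> ^ k) = (\<Sum>i<n. (A ^\<^sub>m k) $$ (i, i))"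
proof -
  obtain es where "char_poly A = (\<Prod>a\<leftarrow>es. [:- a, 1:])"
    using char_poly_factorized[OF A] by blast
  from schur_decomposition_exists[OF A this] obtain B where
    B: "B \<in> carrier_mat n n" "upper_triangular B" "similar_mat A B" by blast
  then obtain P Q where wit: "similar_mat_wit A B P Q" by (auto simp: similar_mat_def)
  note PQ = similar_mat_witD2[OF A wit]
  have "proots (char_poly A) = proots (\<Prod>a\<leftarrow>diag_mat B. [:- a, 1:])"
    using B by (simp add: char_poly_similar[of A B] char_poly_upper_triangular)
  also have "\<dots> = mset (diag_mat B)"
  proof -
    have "proots (\<Prod>a\<leftarrow>xs. [:- a, 1:]) = mset xs" for xs :: "complex list"
    proof (induction xs)
      case (Cons a xs)
      have "(\<Prod>a\<leftarrow>xs. [:- a, 1:]) \<noteq> 0" by (auto simp: prod_list_zero_iff)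
      then show ?case using Cons by (simp add: proots_mult del: mult_pCons_left)
    qed simp
    then show ?thesis .
  qed
  finally have "(\<Sum>\<eta>\<in>#proots (char_poly A). \<eta> ^ k) = (\<Sum>\<eta>\<leftarrow>diag_mat B. \<eta> ^ k)"
    by (metis mset_map sum_mset_sum_list)
  also have "\<dots> = (\<Sum>i<n. (B $$ (i, i)) ^ k)"
    using B by (simp add: diag_mat_def interv_sum_list_conv_sum_set_nat atLeast0LessThan comp_def)
  also have "\<dots> = (\<Sum>i<n. (B ^\<^sub>m k) $$ (i, i))"
    using upper_triangular_power[OF B(1,2)] by simp
  \<comment> \<open>The trace of \<open>P * (B ^\<^sub>m k * Q)\<close> is that of
    \<open>B ^\<^sub>m k * Q * P\<close>, and \<open>Q * P\<close> is the identity.\<close>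
  also have "\<dots> = (\<Sum>i<n. (P * (B ^\<^sub>m k * Q)) $$ (i, i))"
  proof -
    have "B ^\<^sub>m k * Q * P = B ^\<^sub>m k"
      using PQ by (subst assoc_mult_mat[of _ n n _ n _ n]) auto
    moreover have "B ^\<^sub>m k * Q \<in> carrier_mat n n" using PQ by auto
    ultimately show ?thesis
      using sum_diag_mult_commute[of P n "B ^\<^sub>m k * Q"] PQ by metis
  qed
  also have "P * (B ^\<^sub>m k * Q) = A ^\<^sub>m k"
    using PQ by (subst similar_mat_wit_pow_id[OF wit])
      (subst assoc_mult_mat[of _ n n _ n _ n], auto)
  finally show ?thesis .
qed

lemma pow_mat_Suc_left:
  fixes A :: "'a :: semiring_1 mat"
  assumes "A \<in> carrier_mat n n"
  shows "A ^\<^sub>m Suc k = A * A ^\<^sub>m k"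
proof (induction k)
  case (Suc k)
  then show ?case
    using assms by (metis assoc_mult_mat pow_carrier_mat pow_mat.simps(2))
qed (use assms in simp)

section \<open>Pruning as passage to a greatest index set\<close>

text \<open>A set \<open>S\<close> without zero rows inside it never loses an index: a row vanishing
  on all of \<open>I\<close> cannot belong to \<open>S \<subseteq> I\<close>. Hence the order of the
  deletions does not affect the result.\<close>

lemma prunes_to_greatest:
  assumes "prunes_to A I J"
  shows "J \<subseteq> I \<and> (\<forall>i\<in>J. \<exists>j\<in>J. A i j \<noteq> 0) \<and>
    (\<forall>S\<subseteq>I. (\<forall>i\<in>S. \<exists>j\<in>S. A i j \<noteq> 0) \<longrightarrow> S \<subseteq> J)"
  using assms
proof (induction rule: prunes_to.induct)
  case (stop I)
  then show ?case by simp
next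
  case (delete i I J)
  have "S \<subseteq> J" if S: "S \<subseteq> I" "\<forall>i\<in>S. \<exists>j\<in>S. A i j \<noteq> 0" for S
  proof -
    have "i \<notin> S" using S delete.hyps(2) by (meson subsetD)
    with S(1) have "S \<subseteq> I - {i}" by auto
    with S(2) show ?thesis using delete.IH by simp
  qed
  moreover have "J \<subseteq> I" using delete.IH by auto
  ultimately show ?case using delete.IH by simp
qed

section \<open>Sums over bit vectors and over periods\<close>

lemma UNIV_bit: "(UNIV :: bit set) = {0, 1}"
  by (auto intro: bit.exhaust)

lemma card_UNIV_bit: "card (UNIV :: bit set) = 2"
  by (simp add: UNIV_bit)

lemma sum_PiE_Suc:
  fixes g :: "(nat \<Rightarrow> bit) \<Rightarrow> 'a :: comm_monoid_add"
  shows "(\<Sum>x\<in>{1..Suc k} \<rightarrow>\<^sub>E UNIV. g x) =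
    (\<Sum>x\<in>{1..k} \<rightarrow>\<^sub>E UNIV. \<Sum>\<epsilon>\<in>UNIV. g (x(Suc k := \<epsilon>)))"
proof -
  have "(\<Sum>x\<in>{1..Suc k} \<rightarrow>\<^sub>E UNIV. g x) =
      (\<Sum>x\<in>(\<lambda>(\<epsilon>, x). x(Suc k := \<epsilon>)) ` (UNIV \<times> ({1..k} \<rightarrow>\<^sub>E UNIV)). g x)"
    by (simp add: atLeastAtMostSuc_conv PiE_insert_eq)
  also have "\<dots> = (\<Sum>(\<epsilon>, x)\<in>UNIV \<times> ({1..k} \<rightarrow>\<^sub>E UNIV). g (x(Suc k := \<epsilon>)))"
    by (subst sum.reindex[OF inj_combinator]) (auto simp: case_prod_unfold)
  also have "\<dots> = (\<Sum>x\<in>{1..k} \<rightarrow>\<^sub>E UNIV. \<Sum>\<epsilon>\<in>UNIV. g (x(Suc k := \<epsilon>)))"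
    by (subst sum.cartesian_product[symmetric], subst sum.swap) simp
  finally show ?thesis .
qed

lemma sum_bit_sign:
  "(\<Sum>x\<in>{1..n} \<rightarrow>\<^sub>E UNIV. bit_sign (g x)) = 2 ^ n - 2 * of_nat (hamming_weight n g)"
proof -
  let ?X = "{1..n} \<rightarrow>\<^sub>E (UNIV :: bit set)"
  have fin: "finite ?X" by (intro finite_PiE) (auto simp: finite_UNIV_bit)
  have "(\<Sum>x\<in>?X. bit_sign (g x)) = (\<Sum>x\<in>?X. 1 - 2 * (if g x = 1 then 1 else 0))"
    by (intro sum.cong) (auto simp: bit_sign_def)
  also have "\<dots> = of_nat (card ?X) - 2 * of_nat (card {x \<in> ?X. g x = 1})"
    using fin by (simp add: sum_subtractf sum.If_cases Int_def flip: sum_distrib_left)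
  also have "card ?X = 2 ^ n" by (simp add: card_PiE card_UNIV_bit)
  finally show ?thesis by (simp add: hamming_weight_def)
qed

text \<open>Moving the window by one drops its first term and adds one a period later, which is
  equal.\<close>

lemma sum_periodic_shift:
  fixes g :: "int \<Rightarrow> 'a :: ab_group_add"
  assumes "\<And>j. g (j + int n) = g j"
  shows "(\<Sum>r = 1..n. g (int r + int c)) = (\<Sum>r = 1..n. g (int r))"
proof (induction c)
  case (Suc c)
  have "(\<Sum>r = 1..n. g (int r + int (Suc c))) = (\<Sum>r = Suc 1..Suc n. g (int r + int c))"
    by (subst sum.shift_bounds_cl_Suc_ivl) (simp add: algebra_simps)
  also have "\<dots> = (\<Sum>r = 1..n. g (int r + int c)) + g (1 + int c + int n) - g (1 + int c)"
  proof (cases "n = 0")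
    case False
    then have "(\<Sum>r = 1..Suc n. g (int r + int c)) =
        g (int 1 + int c) + (\<Sum>r = Suc 1..Suc n. g (int r + int c))"
      by (intro sum.atLeast_Suc_atMost) auto
    then show ?thesis by (simp add: algebra_simps)
  qed simp
  also have "\<dots> = (\<Sum>r = 1..n. g (int r))" using Suc assms by simp
  finally show ?case .
qed simp

section \<open>Histories, runs and periodic extensions\<close>

text \<open>\<open>hist T s y\<close> is the state at time \<open>s\<close>, where \<open>y j\<close> is the bit that was fed in at time \<open>j\<close>.\<close>

definition hist :: "nat set \<Rightarrow> int \<Rightarrow> (int \<Rightarrow> bit) \<Rightarrow> state" where
  "hist T s y = (\<lambda>t\<in>T. \<lambda>i\<in>{..<t - 1}. y (s + int i + 2 - int t))"

text \<open>The states whose components are all read from one common bit sequence. Time 0 stands for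
  every time, as the sequence may be translated.\<close>

definition histories :: "nat set \<Rightarrow> state set" where
  "histories T = range (hist T 0)"

primrec run :: "nat set \<Rightarrow> (nat \<Rightarrow> bit) \<Rightarrow> state \<Rightarrow> nat \<Rightarrow> state" where
  "run T x u 0 = u"
| "run T x u (Suc k) = shift T (x (Suc k)) (run T x u k)"

text \<open>The exponent of -1 in the product of the matrix entries along the run: step
  \<open>r\<close> leaves the state reached after \<open>r - 1\<close> inputs and feeds in
  \<open>x r\<close>.\<close>

definition phase :: "nat set \<Rightarrow> (nat \<Rightarrow> bit) \<Rightarrow> state \<Rightarrow> nat \<Rightarrow> bit" where
  "phase T x u k = (\<Sum>r = 1..k. x r * head_sum T (run T x u (r - 1)))"

text \<open>The off-diagonal entries of the row \<^const>\<open>None\<close> do not enter a trace and are left undefined.\<close>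

fun walk_sum :: "nat set \<Rightarrow> nat \<Rightarrow> state option \<Rightarrow> state option \<Rightarrow> complex" where
  "walk_sum T k (Some v) (Some u) =
     (\<Sum>x\<in>{1..k} \<rightarrow>\<^sub>E UNIV. if run T x u k = v then bit_sign (phase T x u k) else 0)"
| "walk_sum T k (Some v) None = 0"
| "walk_sum T k None None = 2 ^ k"
| "walk_sum T k None (Some u) = undefined"

text \<open>Defined on all integers because the state at time 0 consists of bits at times \<le>
  0.\<close>

definition periodic :: "nat \<Rightarrow> (nat \<Rightarrow> bit) \<Rightarrow> int \<Rightarrow> bit" where
  "periodic n x j = x (nat ((j - 1) mod int n) + 1)"

lemma run_cong:
  "(\<And>r. r \<in> {1..k} \<Longrightarrow> x r = y r) \<Longrightarrow> run T x u k = run T y u k"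
  by (induction k) auto

lemma phase_Suc:
  "phase T (x(Suc k := \<epsilon>)) u (Suc k) = phase T x u k + \<epsilon> * head_sum T (run T x u k)"
proof -
  have "run T (x(Suc k := \<epsilon>)) u r = run T x u r" if "r \<le> k" for r
    using that by (intro run_cong) auto
  then have "(\<Sum>r = 1..k. (x(Suc k := \<epsilon>)) r * head_sum T (run T (x(Suc k := \<epsilon>)) u (r - 1)))
      = phase T x u k" and "run T (x(Suc k := \<epsilon>)) u k = run T x u k"
    unfolding phase_def by (intro sum.cong refl, auto)
  then show ?thesis
    unfolding phase_def[of T "x(Suc k := \<epsilon>)"] by (subst sum.nat_ivl_Suc') (auto simp: add.commute)
qed

lemma periodic_add: "periodic n x (j + int n) = periodic n x j"
proof -
  have "(j + int n - 1) mod int n = (j - 1) mod int n"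
    by (metis add.commute add_diff_eq mod_add_self1)
  then show ?thesis by (simp add: periodic_def)
qed

lemma periodic_of_nat:
  assumes "r \<in> {1..n}"
  shows "periodic n x (int r) = x r"
proof -
  have "(int r - 1) mod int n = int r - 1" using assms by (intro mod_pos_pos_trivial) auto
  moreover have "nat (int r - 1) + 1 = r" using assms by auto
  ultimately show ?thesis by (simp add: periodic_def)
qed

lemma periodic_cyc:
  assumes "k \<ge> 1"
  shows "periodic n x (int k) = x (cyc n k)"
proof -
  have "int k - 1 = int (k - 1)" using assms by auto
  then have "nat ((int k - 1) mod int n) = (k - 1) mod n"
    by (metis nat_int of_nat_mod)
  then show ?thesis by (simp add: periodic_def cyc_def)
qed

section \<open>States read off from bit sequences\<close>

locale quadratic_rule =
  fixes T :: "nat set" and M :: nat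
  assumes finite_T: "finite T" and nonempty_T: "T \<noteq> {}"
    and T_gt_1: "\<And>t. t \<in> T \<Longrightarrow> 1 < t"
    and M_eq: "M = Max ((\<lambda>t. t - 1) ` T)"
begin

lemma Suc_M_in: "Suc M \<in> T"
proof -
  have "M \<in> (\<lambda>t. t - 1) ` T"
    unfolding M_eq using finite_T nonempty_T by (intro Max_in) auto
  then obtain t where "t \<in> T" "M = t - 1" by blast
  with T_gt_1[of t] show ?thesis by simp
qed

lemma T_le: assumes "t \<in> T"
  shows "t \<le> Suc M"
proof -
  have "t - 1 \<le> M" unfolding M_eq using finite_T assms by (intro Max_ge) auto
  then show ?thesis by simp
qed

lemma M_pos: "M > 0"
  using T_gt_1[OF Suc_M_in] by simp

text \<open>Component \<open>t\<close> holds the last \<open>t - 1\<close> bits, so the longest one,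
  \<open>t = Suc M\<close>, holds the last \<open>M\<close> bits and determines all others.\<close>

lemma hist_eq_iff:
  "hist T s y = hist T s' y' \<longleftrightarrow> (\<forall>j\<in>{1 - int M..0}. y (s + j) = y' (s' + j))"
proof
  assume eq: "hist T s y = hist T s' y'"
  show "\<forall>j\<in>{1 - int M..0}. y (s + j) = y' (s' + j)"
  proof
    fix j assume j: "j \<in> {1 - int M..0}"
    \<comment> \<open>The position of time offset \<open>j\<close> in component
      \<open>Suc M\<close>, from \<open>j = i + 2 - (M + 1)\<close>.\<close>
    define i where "i = nat (j + int M - 1)"
    have i: "i < Suc M - 1" "j = int i + 2 - int (Suc M)" using j by (auto simp: i_def)
    have "hist T s y (Suc M) i = hist T s' y' (Suc M) i" using eq by simp
    with i(1) Suc_M_in show "y (s + j) = y' (s' + j)"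
      by (simp add: hist_def i(2) algebra_simps)
  qed
next
  assume *: "\<forall>j\<in>{1 - int M..0}. y (s + j) = y' (s' + j)"
  have "y (s + int i + 2 - int t) = y' (s' + int i + 2 - int t)" if "t \<in> T" "i < t - 1" for t i
  proof -
    have "int i + 2 - int t \<in> {1 - int M..0}" using that T_le[of t] by auto
    from bspec[OF * this] show ?thesis by (simp add: algebra_simps)
  qed
  then show "hist T s y = hist T s' y'"
    unfolding hist_def by (intro restrict_ext) auto
qed

lemma shift_hist: "shift T (y (s + 1)) (hist T s y) = hist T (s + 1) y"
  unfolding shift_def hist_def
proof (intro restrict_ext)
  fix t i assume "t \<in> T" "i \<in> {..<t - 1}"
  then show "(if i = t - 2 then y (s + 1)
      else (\<lambda>t\<in>T. \<lambda>i\<in>{..<t - 1}. y (s + int i + 2 - int t)) t (i + 1))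
    = y (s + 1 + int i + 2 - int t)"
    using T_gt_1[of t] by (auto simp: algebra_simps of_nat_diff)
qed

lemma hist_in_histories: "hist T s y \<in> histories T"
proof -
  have "hist T s y = hist T 0 (\<lambda>j. y (s + j))" by (simp add: hist_eq_iff)
  then show ?thesis by (simp add: histories_def)
qed

text \<open>A state at time 0 does not see the bit at time 1, which may therefore be overwritten by
  the next input.\<close>

lemma shift_hist_0: "shift T \<epsilon> (hist T 0 y) = hist T 1 (y(1 := \<epsilon>))"
proof -
  have "hist T 0 y = hist T 0 (y(1 := \<epsilon>))" by (simp add: hist_eq_iff)
  then show ?thesis using shift_hist[of "y(1 := \<epsilon>)" 0] by simp
qed

lemma shift_in_histories: "u \<in> histories T \<Longrightarrow> shift T \<epsilon> u \<in> histories T"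
  unfolding histories_def by (auto simp: shift_hist_0 hist_in_histories[unfolded histories_def])

lemma run_in_histories: "u \<in> histories T \<Longrightarrow> run T x u k \<in> histories T"
  by (induction k) (auto intro: shift_in_histories)

lemma hist_in_states: "hist T s y \<in> states T"
  unfolding states_def by (intro PiE_I) (simp_all add: hist_def)

lemma histories_subset_states: "histories T \<subseteq> states T"
  using hist_in_states by (auto simp: histories_def)

lemma head_sum_hist: "head_sum T (hist T s y) = (\<Sum>t\<in>T. y (s + 2 - int t))"
  unfolding head_sum_def hist_def using T_gt_1 by (intro sum.cong) auto

lemma run_hist:
  "(\<And>r. r \<in> {1..k} \<Longrightarrow> y (int r) = x r) \<Longrightarrow> run T x (hist T 0 y) k = hist T (int k) y"
proof (induction k)
  case (Suc k)
  have "run T x (hist T 0 y) (Suc k) = shift T (y (int k + 1)) (hist T (int k) y)"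
    using Suc.IH Suc.prems Suc.prems[of "Suc k"] by (simp add: algebra_simps)
  then show ?case using shift_hist[of y "int k"] by (simp add: add.commute)
qed simp

lemma histories_eq_image: "histories T = hist T 0 ` ({1 - int M..0} \<rightarrow>\<^sub>E UNIV)"
proof -
  have "hist T 0 y \<in> hist T 0 ` ({1 - int M..0} \<rightarrow>\<^sub>E UNIV)" for y
    by (rule image_eqI[of _ _ "restrict y {1 - int M..0}"]) (auto simp: hist_eq_iff)
  then show ?thesis by (auto simp: histories_def)
qed

lemma finite_histories: "finite (histories T)"
  unfolding histories_eq_image by (intro finite_imageI finite_PiE) (auto simp: finite_UNIV_bit)

text \<open>By \<open>hist_eq_iff\<close>, histories correspond to windows of bits at the
  \<open>M\<close> times from \<open>1 - M\<close> to 0.\<close>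

lemma card_histories: "card (histories T) = 2 ^ M"
proof -
  have "inj_on (hist T 0) ({1 - int M..0} \<rightarrow>\<^sub>E UNIV)"
    by (intro inj_onI PiE_ext) (auto simp: hist_eq_iff)
  then show ?thesis
    unfolding histories_eq_image by (simp add: card_image card_PiE card_UNIV_bit)
qed

section \<open>The indices that survive pruning\<close>

lemma transfer_entry_nonzero: "transfer_entry T (shift T \<epsilon> u) u \<noteq> 0"
  using transfer_entry_shift[OF nonempty_T T_gt_1, of \<epsilon> u] by (simp add: bit_sign_def)

lemma history_predecessor:
  assumes "v \<in> histories T"
  shows "\<exists>u\<in>histories T. \<exists>\<epsilon>. v = shift T \<epsilon> u"
proof -
  obtain y where v: "v = hist T 0 y" using assms by (auto simp: histories_def)
  have "v = shift T (y 0) (hist T (-1) y)" using shift_hist[of y "-1"] v by simp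
  then show ?thesis using hist_in_histories by blast
qed

text \<open>By \<open>prunes_to_greatest\<close> two inclusions remain. Among the histories and the
  final index no row is zero: a history has a predecessor history, and the final row has its
  diagonal entry 2. Conversely, a state of \<open>J\<close> can be traced back \<open>M\<close>
  steps within \<open>J\<close>, and \<open>M\<close> shifts fill every component with the common
  inputs.\<close>

lemma pruned_indices:
  assumes "prunes_to (expanded_entry T) (expanded_indices T) J"
  shows "J = insert None (Some ` histories T)"
proof
  have greatest: "J \<subseteq> expanded_indices T"
    "\<And>i. i \<in> J \<Longrightarrow> \<exists>j\<in>J. expanded_entry T i j \<noteq> 0"
    "\<forall>S\<subseteq>expanded_indices T. (\<forall>i\<in>S. \<exists>j\<in>S. expanded_entry T i j \<noteq> 0) \<longrightarrow> S \<subseteq> J"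
    using prunes_to_greatest[OF assms] by simp_all
  have "insert None (Some ` histories T) \<subseteq> expanded_indices T"
    using histories_subset_states by (auto simp: expanded_indices_def)
  moreover have "\<exists>j\<in>insert None (Some ` histories T). expanded_entry T i j \<noteq> 0"
    if i: "i \<in> insert None (Some ` histories T)" for i
  proof (cases i)
    case (Some v)
    with i obtain u \<epsilon> where "u \<in> histories T" "v = shift T \<epsilon> u"
      using history_predecessor by blast
    then show ?thesis using Some transfer_entry_nonzero by auto
  qed auto
  ultimately show "insert None (Some ` histories T) \<subseteq> J"
    using greatest(3)[rule_format, of "insert None (Some ` histories T)"] by simp
  have pred: "\<exists>u \<epsilon>. Some u \<in> J \<and> v = shift T \<epsilon> u" if v: "Some v \<in> J" for v
  proof -
    obtain j where j: "j \<in> J" "expanded_entry T (Some v) j \<noteq> 0"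
      using greatest(2)[OF v] by blast
    then obtain u where u: "j = Some u" by (cases j) auto
    with j(2) have "transfer_entry T v u \<noteq> 0" by simp
    then obtain \<epsilon> where "v = shift T \<epsilon> u" using transfer_entry_eq_0 by blast
    with j(1) u show ?thesis by blast
  qed
  \<comment> \<open>A state reached after \<open>k\<close> steps agrees with a history in the last \<open>k\<close> entries of each component.\<close>
  have approx: "\<exists>y. \<forall>t\<in>T. \<forall>i<t - 1. t - 1 \<le> i + k \<longrightarrow> v t i = y (int i + 2 - int t)"
    if "Some v \<in> J" for v k
    using that
  proof (induction k arbitrary: v)
    case (Suc k)
    obtain u \<epsilon> where u: "Some u \<in> J" "v = shift T \<epsilon> u" using pred Suc.prems by blast
    obtain y where y: "\<And>t i. t \<in> T \<Longrightarrow> i < t - 1 \<Longrightarrow> t - 1 \<le> i + k \<Longrightarrow> u t i = y (int i + 2 - int t)"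
      using Suc.IH[OF u(1)] by blast
    \<comment> \<open>Position \<open>t - 2\<close> is offset 0 and holds the new input; an older
      bit of \<open>v\<close> is the bit of \<open>u\<close> one position further on.\<close>
    have "v t i = (if int i + 2 - int t = 0 then \<epsilon> else y (int i + 2 - int t + 1))"
      if "t \<in> T" "i < t - 1" "t - 1 \<le> i + Suc k" for t i
    proof (cases "i = t - 2")
      case False
      with that have "u t (i + 1) = y (int (i + 1) + 2 - int t)" by (intro y) auto
      with that False show ?thesis by (auto simp: u(2) shift_def algebra_simps)
    qed (use that in \<open>auto simp: u(2) shift_def\<close>)
    then show ?case
      by (intro exI[of _ "\<lambda>j. if j = 0 then \<epsilon> else y (j + 1)"] ballI allI impI)
  qed auto
  show "J \<subseteq> insert None (Some ` histories T)"
  proof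
    fix j assume j: "j \<in> J"
    show "j \<in> insert None (Some ` histories T)"
    proof (cases j)
      case (Some v)
      \<comment> \<open>For \<open>k = M\<close> the condition \<open>t - 1 \<le> i + k\<close>
        holds at every position, as \<open>t \<le> Suc M\<close>.\<close>
      obtain y where y: "\<forall>t\<in>T. \<forall>i<t - 1. t - 1 \<le> i + M \<longrightarrow> v t i = y (int i + 2 - int t)"
        using approx[of v M] j Some by blast
      have v: "v \<in> (\<Pi>\<^sub>E t\<in>T. {..<t - 1} \<rightarrow>\<^sub>E UNIV)"
        using greatest(1) j Some by (auto simp: expanded_indices_def states_def)
      have h: "hist T 0 y \<in> (\<Pi>\<^sub>E t\<in>T. {..<t - 1} \<rightarrow>\<^sub>E UNIV)"
        using hist_in_states by (simp add: states_def)
      have "v = hist T 0 y"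
      proof (rule PiE_ext[OF v h])
        fix t assume t: "t \<in> T"
        show "v t = hist T 0 y t"
        proof (rule PiE_ext[OF PiE_mem[OF v t] PiE_mem[OF h t]])
          fix i assume i: "i \<in> {..<t - 1}"
          then have "v t i = y (int i + 2 - int t)"
            using y[rule_format, OF t, of i] T_le[OF t] by simp
          then show "v t i = hist T 0 y t i" using t i by (simp add: hist_def)
        qed
      qed
      then show ?thesis using Some by (auto simp: histories_def)
    qed simp
  qed
qed

section \<open>Closed walks and Hamming weights\<close>

text \<open>Closing up means that the last \<open>M\<close> bits at time \<open>k\<close> repeat
  those at time 0; going backwards from time \<open>k\<close>, this forces the whole past to be
  \<open>k\<close>-periodic. The argument covers \<open>k < M\<close>, where the window is longer
  than the period, and so lets the formula start at 1.\<close>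

lemma run_closed_iff:
  assumes k: "k \<ge> 1" and u: "u \<in> histories T"
  shows "run T x u k = u \<longleftrightarrow> u = hist T 0 (periodic k x)"
proof
  assume "u = hist T 0 (periodic k x)"
  moreover have "run T x (hist T 0 (periodic k x)) k = hist T (int k) (periodic k x)"
    by (intro run_hist periodic_of_nat)
  moreover have "hist T (int k) (periodic k x) = hist T 0 (periodic k x)"
    using periodic_add[of k x] by (simp add: hist_eq_iff add.commute)
  ultimately show "run T x u k = u" by simp
next
  assume closed: "run T x u k = u"
  obtain y where "u = hist T 0 y" using u by (auto simp: histories_def)
  \<comment> \<open>Glues the past recorded in \<open>u\<close> to the inputs
    \<open>x\<close>.\<close>
  define z where "z j = (if 1 \<le> j then x (nat j) else y j)" for j
  have u_z: "u = hist T 0 z" unfolding \<open>u = hist T 0 y\<close> by (simp add: hist_eq_iff z_def)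
  have "run T x (hist T 0 z) k = hist T (int k) z" by (intro run_hist) (simp add: z_def)
  with closed u_z have "hist T (int k) z = hist T 0 z" by simp
  then have z_add: "z (int k + j) = z j" if "j \<in> {1 - int M..0}" for j
    using that by (auto simp: hist_eq_iff)
  have "z j = periodic k x j" if "1 - int M \<le> j" "j \<le> int k" for j
    using that
  \<comment> \<open>Strong induction, since a time \<open>j \<le> 0\<close> is compared with
    \<open>j + k\<close>, which is \<open>k\<close> steps later.\<close>
  proof (induction "nat (int k - j)" arbitrary: j rule: less_induct)
    case less
    show ?case
    proof (cases "1 \<le> j")
      case True
      with less.prems have "periodic k x (int (nat j)) = x (nat j)"
        by (intro periodic_of_nat) auto
      with True show ?thesis by (simp add: z_def)
    next
      case False
      have "z (j + int k) = periodic k x (j + int k)"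
        using less.prems False k by (intro less.hyps) auto
      then show ?thesis using z_add[of j] False less.prems by (simp add: periodic_add add.commute)
    qed
  qed
  then show "u = hist T 0 (periodic k x)" unfolding u_z by (simp add: hist_eq_iff)
qed

text \<open>The head of component \<open>t\<close> lies \<open>t - 1\<close> steps before the bit
  being fed in. Over a full period the summation index may be moved by \<open>t - 1\<close>, which
  turns these products into those of the quadratic form.\<close>

lemma phase_closed: "phase T x (hist T 0 (periodic k x)) k = rot_quad T k x"
proof -
  let ?y = "periodic k x"
  have "phase T x (hist T 0 ?y) k = (\<Sum>r = 1..k. \<Sum>t\<in>T. ?y (int r + 1 - int t) * ?y (int r))"
    unfolding phase_def
  proof (rule sum.cong[OF refl])
    fix r assume r: "r \<in> {1..k}"
    have "run T x (hist T 0 ?y) (r - 1) = hist T (int (r - 1)) ?y"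
      using r by (intro run_hist periodic_of_nat) auto
    moreover have "int (r - 1) + 2 = int r + 1" using r by auto
    ultimately show "x r * head_sum T (run T x (hist T 0 ?y) (r - 1)) =
        (\<Sum>t\<in>T. ?y (int r + 1 - int t) * ?y (int r))"
      using periodic_of_nat[OF r, of x]
      by (simp only: head_sum_hist sum_distrib_left) (simp only: mult.commute)
  qed
  also have "\<dots> = (\<Sum>t\<in>T. \<Sum>r = 1..k. ?y (int r + 1 - int t) * ?y (int r))"
    by (rule sum.swap)
  also have "\<dots> = (\<Sum>t\<in>T. \<Sum>r = 1..k. x r * x (cyc k (r + t - 1)))"
  proof (rule sum.cong[OF refl])
    fix t assume t: "t \<in> T"
    let ?g = "\<lambda>j. ?y (j + 1 - int t) * ?y j"
    have "?g (j + int k) = ?g j" for j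
      using periodic_add[of k x j] periodic_add[of k x "j + 1 - int t"] by (simp add: algebra_simps)
    then have "(\<Sum>r = 1..k. ?g (int r)) = (\<Sum>r = 1..k. ?g (int r + int (t - 1)))"
      by (intro sum_periodic_shift[symmetric])
    also have "\<dots> = (\<Sum>r = 1..k. x r * x (cyc k (r + t - 1)))"
    proof (intro sum.cong refl)
      fix r assume r: "r \<in> {1..k}"
      have eq: "int r + int (t - 1) = int (r + t - 1)" "int (r + t - 1) + 1 - int t = int r"
        "r + t - 1 \<ge> 1"
        using r T_gt_1[OF t] by auto
      show "?g (int r + int (t - 1)) = x r * x (cyc k (r + t - 1))"
        unfolding eq periodic_of_nat[OF r] periodic_cyc[OF eq(3)] ..
    qed
    finally show "(\<Sum>r = 1..k. ?g (int r)) = (\<Sum>r = 1..k. x r * x (cyc k (r + t - 1)))" .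
  qed
  also have "\<dots> = rot_quad T k x" unfolding rot_quad_def by (rule sum.swap)
  finally show ?thesis .
qed

text \<open>After exchanging the sums, each \<open>x\<close> closes up from exactly one history and
  contributes the sign of its function value.\<close>

lemma sum_walk_sum_diag:
  assumes "k \<ge> 1"
  shows "(\<Sum>u\<in>histories T. walk_sum T k (Some u) (Some u)) =
    2 ^ k - 2 * of_nat (hamming_weight k (rot_quad T k))"
proof -
  let ?X = "{1..k} \<rightarrow>\<^sub>E (UNIV :: bit set)"
  have "(\<Sum>u\<in>histories T. walk_sum T k (Some u) (Some u)) =
      (\<Sum>x\<in>?X. \<Sum>u\<in>histories T. if run T x u k = u then bit_sign (phase T x u k) else 0)"
    by (simp only: walk_sum.simps) (rule sum.swap)
  also have "\<dots> = (\<Sum>x\<in>?X. \<Sum>u\<in>histories T.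
      if u = hist T 0 (periodic k x) then bit_sign (rot_quad T k x) else 0)"
    using run_closed_iff[OF assms] by (intro sum.cong refl) (simp add: phase_closed)
  also have "\<dots> = (\<Sum>x\<in>?X. bit_sign (rot_quad T k x))"
    using finite_histories hist_in_histories by (intro sum.cong refl) simp
  also have "\<dots> = 2 ^ k - 2 * of_nat (hamming_weight k (rot_quad T k))"
    by (rule sum_bit_sign)
  finally show ?thesis .
qed

text \<open>Splits off the last input. The intermediate state ranges over histories only, because a
  run starting in a history stays among them.\<close>

lemma walk_sum_Suc:
  assumes "u \<in> histories T"
  shows "walk_sum T (Suc k) (Some v) (Some u) =
    (\<Sum>w\<in>histories T. transfer_entry T v w * walk_sum T k (Some w) (Some u))"
proof -
  let ?X = "{1..k} \<rightarrow>\<^sub>E (UNIV :: bit set)"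
  have run_upd: "run T (x(Suc k := \<epsilon>)) u k = run T x u k" for x \<epsilon>
    by (intro run_cong) auto
  have "walk_sum T (Suc k) (Some v) (Some u) = (\<Sum>x\<in>?X. \<Sum>\<epsilon>\<in>UNIV.
      if shift T \<epsilon> (run T x u k) = v
      then bit_sign (phase T x u k + \<epsilon> * head_sum T (run T x u k)) else 0)"
    by (simp only: walk_sum.simps sum_PiE_Suc phase_Suc run.simps run_upd fun_upd_same)
  also have "\<dots> = (\<Sum>x\<in>?X. transfer_entry T v (run T x u k) * bit_sign (phase T x u k))"
    unfolding transfer_entry_def UNIV_bit sum_distrib_right
  proof (intro sum.cong refl)
    fix x \<epsilon>
    show "(if shift T \<epsilon> (run T x u k) = v
        then bit_sign (phase T x u k + \<epsilon> * head_sum T (run T x u k)) else 0) =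
      (if v = shift T \<epsilon> (run T x u k)
        then bit_sign (\<epsilon> * head_sum T (run T x u k)) else 0) * bit_sign (phase T x u k)"
      by (cases "v = shift T \<epsilon> (run T x u k)")
        (auto simp: bit_sign_def)
  qed
  also have "\<dots> = (\<Sum>x\<in>?X. \<Sum>w\<in>histories T.
      if run T x u k = w then transfer_entry T v w * bit_sign (phase T x u k) else 0)"
    using finite_histories run_in_histories[OF assms] by (intro sum.cong refl) simp
  also have "\<dots> = (\<Sum>w\<in>histories T. \<Sum>x\<in>?X.
      if run T x u k = w then transfer_entry T v w * bit_sign (phase T x u k) else 0)"
    by (rule sum.swap)
  also have "\<dots> = (\<Sum>w\<in>histories T. transfer_entry T v w * walk_sum T k (Some w) (Some u))"
    by (intro sum.cong refl) (auto simp: sum_distrib_left intro!: sum.cong)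
  finally show ?thesis .
qed

section \<open>The left kernel of the pruned matrix\<close>

text \<open>The head of component \<open>t\<close> is the bit at time \<open>2 - t\<close>, so the
  bit at time \<open>1 - M\<close> is the head of component \<open>Suc M\<close> and of no
  other.\<close>

lemma head_sum_flip_oldest:
  "head_sum T (hist T 0 (y(1 - int M := y (1 - int M) + 1))) = head_sum T (hist T 0 y) + 1"
proof -
  let ?y = "y(1 - int M := y (1 - int M) + 1)"
  have "head_sum T (hist T 0 ?y) = (\<Sum>t\<in>T. y (2 - int t) + (if t = Suc M then 1 else 0))"
    unfolding head_sum_hist
  proof (intro sum.cong refl)
    fix t
    have "2 - int t = 1 - int M \<longleftrightarrow> t = Suc M" by linarith
    then show "?y (0 + 2 - int t) = y (2 - int t) + (if t = Suc M then 1 else 0)" by simp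
  qed
  also have "\<dots> = (\<Sum>t\<in>T. y (2 - int t)) + (\<Sum>t\<in>T. if t = Suc M then 1 else 0)"
    by (rule sum.distrib)
  also have "(\<Sum>t\<in>T. if t = Suc M then 1 else (0 :: bit)) = 1"
    using finite_T Suc_M_in by (subst sum.delta) auto
  finally show ?thesis by (simp only: head_sum_hist[of 0 y] add_0)
qed

text \<open>The oldest bit is discarded by the next shift, so flipping it in a predecessor changes
  the head sum but not the successors.\<close>

lemma history_two_predecessors:
  assumes "v \<in> histories T"
  obtains u u' \<epsilon> where "u \<in> histories T" "u' \<in> histories T" "head_sum T u' = head_sum T u + 1"
    "v = shift T \<epsilon> u" "\<And>\<delta>. shift T \<delta> u' = shift T \<delta> u"
proof -
  obtain u \<epsilon> where u: "u \<in> histories T" "v = shift T \<epsilon> u"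
    using history_predecessor[OF assms] by blast
  then obtain y where y: "u = hist T 0 y" by (auto simp: histories_def)
  let ?u' = "hist T 0 (y(1 - int M := y (1 - int M) + 1))"
  have "shift T \<delta> ?u' = shift T \<delta> u" for \<delta>
    unfolding y shift_hist_0 using M_pos by (auto simp: hist_eq_iff)
  then show ?thesis
    using that[OF u(1) hist_in_histories _ u(2)] head_sum_flip_oldest[of y] y by blast
qed

text \<open>Flipping the oldest bit of a state keeps its successors but changes one of the two signs in
  its column.\<close>

lemma expanded_left_kernel:
  fixes y :: "state option \<Rightarrow> complex"
  assumes ker: "\<And>j. j \<in> insert None (Some ` histories T) \<Longrightarrow>
      (\<Sum>i\<in>insert None (Some ` histories T). y i * expanded_entry T i j) = 0"
    and i: "i \<in> insert None (Some ` histories T)"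
  shows "y i = 0"
proof -
  have split: "(\<Sum>i\<in>insert None (Some ` histories T). f i) =
      f None + (\<Sum>v\<in>histories T. f (Some v))" for f :: "state option \<Rightarrow> complex"
    using finite_histories by (subst sum.insert) (auto simp: sum.reindex)
  \<comment> \<open>The only nonzero entry of column \<open>None\<close> is 2.\<close>
  have None: "y None = 0" using ker[of None] by (simp add: split)
  have col: "y (Some (shift T 0 u)) + bit_sign (head_sum T u) * y (Some (shift T 1 u)) = 0"
    if u: "u \<in> histories T" for u
  proof -
    have "0 = (\<Sum>v\<in>histories T. y (Some v) * transfer_entry T v u)"
      using ker[of "Some u"] u by (simp add: split None)
    also have "\<dots> = (\<Sum>v\<in>histories T. \<Sum>\<epsilon>\<in>{0, 1}.
        if v = shift T \<epsilon> u then y (Some v) * bit_sign (\<epsilon> * head_sum T u) else 0)"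
      unfolding transfer_entry_def sum_distrib_left by (intro sum.cong refl) auto
    also have "\<dots> = (\<Sum>\<epsilon>\<in>{0, 1}. \<Sum>v\<in>histories T.
        if v = shift T \<epsilon> u then y (Some v) * bit_sign (\<epsilon> * head_sum T u) else 0)"
      by (rule sum.swap)
    also have "\<dots> = (\<Sum>\<epsilon>\<in>{0, 1}. y (Some (shift T \<epsilon> u)) * bit_sign (\<epsilon> * head_sum T u))"
      using finite_histories shift_in_histories[OF u] by (intro sum.cong refl) simp
    finally show ?thesis by (simp add: bit_sign_def mult.commute split: if_splits)
  qed
  have "y (Some v) = 0" if "v \<in> histories T" for v
  proof -
    obtain u u' \<epsilon> where *: "u \<in> histories T" "u' \<in> histories T" "head_sum T u' = head_sum T u + 1"
      "v = shift T \<epsilon> u" "\<And>\<delta>. shift T \<delta> u' = shift T \<delta> u"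
      using history_two_predecessors[OF \<open>v \<in> histories T\<close>] by metis
    \<comment> \<open>The columns of \<open>u\<close> and \<open>u'\<close> give
      \<open>a + b = 0\<close> and \<open>a - b = 0\<close>, in some order, for the values
      \<open>a\<close>, \<open>b\<close> of \<open>y\<close> at the two common successors.\<close>
    have "y (Some (shift T 0 u)) = 0 \<and> y (Some (shift T 1 u)) = 0"
      using col[OF *(1)] col[OF *(2)] unfolding *(3,5)
      by (cases "head_sum T u") (auto simp: bit_sign_def)
    then show ?thesis using *(4) by (cases \<epsilon>) auto
  qed
  then show ?thesis using i None by auto
qed

end

section \<open>Constant coefficients and linear recurrences\<close>

text \<open>A vanishing constant coefficient makes 0 an eigenvalue and the determinant zero. The
  transpose appears because nonsingularity is available in the form of a trivial left
  kernel.\<close>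

lemma char_poly_coeff_0_nonzero:
  fixes A :: "'a :: field mat"
  assumes A: "A \<in> carrier_mat n n"
    and ker: "\<And>v. v \<in> carrier_vec n \<Longrightarrow> A\<^sup>T *\<^sub>v v = 0\<^sub>v n \<Longrightarrow> v = 0\<^sub>v n"
  shows "coeff (char_poly A) 0 \<noteq> 0"
proof
  assume "coeff (char_poly A) 0 = 0"
  then have "eigenvalue A 0" using A by (simp add: eigenvalue_root_char_poly poly_0_coeff_0)
  moreover have "char_matrix A 0 = A" using A by (intro eq_matI) (auto simp: char_matrix_def)
  ultimately have "det A = 0" using A by (simp add: eigenvalue_det)
  then have "det A\<^sup>T = 0" using A by (simp add: det_transpose)
  then show False using ker A det_0_iff_vec_prod_zero[of "A\<^sup>T" n] by auto
qed

text \<open>As \<open>p 0\<close> is invertible, the recursion at \<open>n\<close> recovers the term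
  at \<open>n\<close> from later ones.\<close>

lemma recurrence_backwards_unique:
  fixes p :: "nat \<Rightarrow> 'a :: field"
  assumes p0: "p 0 \<noteq> 0"
    and rec: "\<And>n. n \<ge> 1 \<Longrightarrow> (\<Sum>k = 0..d. p k * v (n + k)) = 0"
      "\<And>n. n \<ge> 1 \<Longrightarrow> (\<Sum>k = 0..d. p k * w (n + k)) = 0"
    and eq: "\<And>n. n \<ge> N \<Longrightarrow> v n = w n"
    and n: "n \<ge> 1"
  shows "v n = w n"
  using n
proof (induction "N - n" arbitrary: n rule: less_induct)
  case less
  show ?case
  proof (cases "n \<ge> N")
    case False
    have "(\<Sum>k = Suc 0..d. p k * v (n + k)) = (\<Sum>k = Suc 0..d. p k * w (n + k))"
      using less False by (intro sum.cong refl arg_cong2[of _ _ _ _ "(*)"] less.hyps) auto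
    then have "p 0 * v n + (\<Sum>k = Suc 0..d. p k * w (n + k)) =
        p 0 * w n + (\<Sum>k = Suc 0..d. p k * w (n + k))"
      using rec[OF less.prems] by (simp add: sum.atLeast_Suc_atMost)
    then have "p 0 * v n = p 0 * w n" by (rule add_right_imp_eq)
    with p0 show ?thesis by simp
  qed (rule eq)
qed

text \<open>Each root contributes a geometric solution, with sum
  \<open>\<eta> ^ n * poly p \<eta>\<close>. An arbitrary multiset \<open>S\<close> of roots lets
  the root 2 and the other roots be treated separately.\<close>

lemma rec_sum_proots:
  fixes p :: "complex poly"
  assumes "\<And>\<eta>. \<eta> \<in># S \<Longrightarrow> poly p \<eta> = 0" "degree p = d"
  shows "(\<Sum>k = 0..d. coeff p k * (\<Sum>\<eta>\<in>#S. \<eta> ^ (n + k))) = 0"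
  using assms(1)
proof (induction S)
  case (add \<eta> S)
  have "(\<Sum>k = 0..d. coeff p k * \<eta> ^ (n + k)) = \<eta> ^ n * poly p \<eta>"
    unfolding poly_altdef assms(2) atMost_atLeast0 sum_distrib_left
    by (intro sum.cong) (simp_all add: power_add mult_ac)
  with add show ?case by (simp add: distrib_left sum.distrib)
qed simp

section \<open>Powers and roots of the rules matrix\<close>

locale rules_matrix = quadratic_rule +
  fixes R :: "complex mat" and xs :: "state option list"
  assumes distinct_xs: "distinct xs"
    and set_xs: "set xs = insert None (Some ` histories T)"
    and R_eq: "R = mat (length xs) (length xs) (\<lambda>(a, b). expanded_entry T (xs ! a) (xs ! b))"
begin

lemma length_xs: "length xs = 2 ^ M + 1"
proof -
  have "length xs = card (set xs)" using distinct_xs by (simp add: distinct_card)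
  also have "\<dots> = Suc (card (Some ` histories T))"
    unfolding set_xs using finite_histories by (subst card_insert_disjoint) auto
  finally show ?thesis by (simp add: card_image card_histories)
qed

lemma R_carrier: "R \<in> carrier_mat (length xs) (length xs)"
  by (simp add: R_eq)

lemma sum_nth: "(\<Sum>a<length xs. f (xs ! a)) = f None + (\<Sum>u\<in>histories T. f (Some u))"
  for f :: "state option \<Rightarrow> complex"
proof -
  have "(\<Sum>a<length xs. f (xs ! a)) = (\<Sum>i\<in>insert None (Some ` histories T). f i)"
    by (intro sum.reindex_bij_betw bij_betw_nth) (simp_all add: distinct_xs set_xs)
  also have "\<dots> = f None + (\<Sum>u\<in>histories T. f (Some u))"
    using finite_histories by (subst sum.insert) (auto simp: sum.reindex)
  finally show ?thesis .
qed

text \<open>On pairs of histories the inductive step is \<open>walk_sum_Suc\<close>. The excluded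
  entries are those where \<open>walk_sum\<close> is undefined.\<close>

lemma index_power:
  assumes "a < length xs" "b < length xs" "\<not> (xs ! a = None \<and> xs ! b \<noteq> None)"
  shows "(R ^\<^sub>m k) $$ (a, b) = walk_sum T k (xs ! a) (xs ! b)"
  using assms
proof (induction k arbitrary: a b)
  case 0
  have "xs ! a = xs ! b \<longleftrightarrow> a = b" using distinct_xs 0 by (simp add: nth_eq_iff_index_eq)
  moreover have "dim_row R = length xs" by (simp add: R_eq)
  ultimately show ?case using 0
    by (cases "xs ! a"; cases "xs ! b") (auto simp: phase_def bit_sign_def)
next
  case (Suc k)
  have "(R ^\<^sub>m Suc k) $$ (a, b) = (\<Sum>c<length xs. R $$ (a, c) * (R ^\<^sub>m k) $$ (c, b))"
    unfolding pow_mat_Suc_left[OF R_carrier] using Suc.prems R_carrier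
    by (intro index_mult_mat_sum) auto
  also have "\<dots> = (\<Sum>c<length xs. expanded_entry T (xs ! a) (xs ! c) * walk_sum T k (xs ! c) (xs ! b))"
  proof (intro sum.cong refl)
    fix c assume c: "c \<in> {..<length xs}"
    show "R $$ (a, c) * (R ^\<^sub>m k) $$ (c, b) =
        expanded_entry T (xs ! a) (xs ! c) * walk_sum T k (xs ! c) (xs ! b)"
    proof (cases "xs ! c = None \<and> xs ! b \<noteq> None")
      \<comment> \<open>The induction hypothesis is silent here, but the left factor lies in column
        \<open>None\<close> outside row \<open>None\<close> and is zero.\<close>
      case True
      then obtain v where "xs ! a = Some v" using Suc.prems(3) by auto
      with True c Suc.prems show ?thesis by (simp add: R_eq)
    next
      case False
      then show ?thesis using Suc.IH[of c b] c Suc.prems by (simp add: R_eq)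
    qed
  qed
  also have "\<dots> = walk_sum T (Suc k) (xs ! a) (xs ! b)"
  proof (cases "xs ! b")
    case None
    then show ?thesis unfolding sum_nth[of "\<lambda>i. expanded_entry T (xs ! a) i * walk_sum T k i (xs ! b)"]
      by (cases "xs ! a") auto
  next
    case (Some u)
    then obtain v where v: "xs ! a = Some v" using Suc.prems(3) by auto
    have "u \<in> histories T" using Some Suc.prems(2) set_xs nth_mem by force
    then show ?thesis
      unfolding sum_nth[of "\<lambda>i. expanded_entry T (xs ! a) i * walk_sum T k i (xs ! b)"]
      by (simp only: v Some walk_sum_Suc expanded_entry.simps mult_zero_left add_0_left)
  qed
  finally show ?case .
qed

text \<open>The trace splits into the corner entry \<open>2 ^ k\<close> and the closed walks through
  histories.\<close>

lemma sum_proots_power: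
  assumes "k \<ge> 1"
  shows "(\<Sum>\<eta>\<in>#proots (char_poly R). \<eta> ^ k) =
    2 ^ k + (2 ^ k - 2 * of_nat (hamming_weight k (rot_quad T k)))"
proof -
  have "(\<Sum>\<eta>\<in>#proots (char_poly R). \<eta> ^ k) = (\<Sum>a<length xs. walk_sum T k (xs ! a) (xs ! a))"
    unfolding sum_proots_char_poly_power[OF R_carrier] by (intro sum.cong refl index_power) auto
  also have "\<dots> = 2 ^ k + (\<Sum>u\<in>histories T. walk_sum T k (Some u) (Some u))"
    by (subst sum_nth[of "\<lambda>i. walk_sum T k i i"]) (simp only: walk_sum.simps)
  finally show ?thesis by (simp only: sum_walk_sum_diag[OF assms])
qed

text \<open>Column \<open>None\<close> is twice a unit vector, which is therefore an
  eigenvector.\<close>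

lemma eigenvalue_2: "eigenvalue R 2"
proof -
  have "None \<in> set xs" by (simp add: set_xs)
  then obtain a where a: "a < length xs" "xs ! a = None" by (auto simp: in_set_conv_nth)
  let ?v = "unit_vec (length xs) a"
  have "R *\<^sub>v ?v = 2 \<cdot>\<^sub>v ?v"
  proof (rule eq_vecI)
    fix b assume b: "b < dim_vec (2 \<cdot>\<^sub>v ?v :: complex vec)"
    then have "(R *\<^sub>v ?v) $ b = expanded_entry T (xs ! b) (xs ! a)"
      using a by (simp add: R_eq)
    also have "\<dots> = (2 \<cdot>\<^sub>v ?v) $ b"
    proof (cases "xs ! b")
      case None
      with a b distinct_xs have "b = a" by (simp add: nth_eq_iff_index_eq[symmetric])
      with a show ?thesis by simp
    next
      case (Some v)
      with a b show ?thesis by auto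
    qed
    finally show "(R *\<^sub>v ?v) $ b = (2 \<cdot>\<^sub>v ?v) $ b" .
  qed (simp add: R_eq)
  moreover have "?v \<noteq> 0\<^sub>v (length xs)"
    using a by (metis index_unit_vec(1) index_zero_vec(1) zero_neq_one)
  ultimately show ?thesis
    unfolding eigenvalue_def eigenvector_def by (intro exI[of _ ?v]) (simp add: R_eq)
qed

lemma coeff_0_nonzero: "coeff (char_poly R) 0 \<noteq> 0"
proof (rule char_poly_coeff_0_nonzero[OF R_carrier])
  fix v assume v: "v \<in> carrier_vec (length xs)" and ker: "R\<^sup>T *\<^sub>v v = 0\<^sub>v (length xs)"
  \<comment> \<open>Carries \<open>v\<close> from list positions over to indices, where
    \<open>expanded_left_kernel\<close> applies; distinctness makes the position unique.\<close>
  define y where "y i = v $ (THE a. a < length xs \<and> xs ! a = i)" for i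
  have y: "y (xs ! a) = v $ a" if "a < length xs" for a
    unfolding y_def using that distinct_xs
    by (intro arg_cong[of _ _ "\<lambda>a. v $ a"] the_equality) (auto simp: nth_eq_iff_index_eq)
  have "(\<Sum>i\<in>set xs. y i * expanded_entry T i j) = 0" if j: "j \<in> set xs" for j
  proof -
    obtain b where b: "b < length xs" "j = xs ! b" using j by (auto simp: in_set_conv_nth)
    have "(\<Sum>i\<in>set xs. y i * expanded_entry T i j) =
        (\<Sum>a<length xs. y (xs ! a) * expanded_entry T (xs ! a) j)"
      using distinct_xs by (intro sum.reindex_bij_betw[symmetric] bij_betw_nth) auto
    also have "\<dots> = (\<Sum>a<length xs. R $$ (a, b) * v $ a)"
      using b by (intro sum.cong) (auto simp: y R_eq)
    also have "\<dots> = (R\<^sup>T *\<^sub>v v) $ b"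
      using v b R_carrier by (auto simp: scalar_prod_def atLeast0LessThan intro!: sum.cong)
    finally show ?thesis using ker b by simp
  qed
  then have "y i = 0" if "i \<in> set xs" for i
    using expanded_left_kernel[of y i] that unfolding set_xs by blast
  then show "v = 0\<^sub>v (length xs)"
    using v y by (intro eq_vecI) (auto simp: nth_mem)
qed

end

section \<open>The weight formula and the unique backward extension\<close>

theorem theorem1p1:
  fixes T :: "nat set" and M :: nat and R :: "complex mat"
  assumes "finite T" and "T \<noteq> {}" and "\<forall>t\<in>T. 1 < t"
    and "M = Max ((\<lambda>t. t - 1) ` T)"
    and "is_rules_matrix T R"
  shows "R \<in> carrier_mat (2 ^ M + 1) (2 ^ M + 1) \<and>
    2 \<in># proots (char_poly R) \<and>
    size (proots (char_poly R) - {#2#}) = 2 ^ M \<and>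
    (\<exists>!w. extends_weights T M R w) \<and>
    (\<forall>w. extends_weights T M R w \<longrightarrow>
      (\<forall>n\<ge>1. w n = 2 ^ (n - 1) - 1 / 2 * (\<Sum>\<eta>\<in>#proots (char_poly R) - {#2#}. \<eta> ^ n)))"
proof -
  interpret quadratic_rule T M using assms by unfold_locales auto
  obtain xs where xs: "distinct xs"
    "prunes_to (expanded_entry T) (expanded_indices T) (set xs)"
    "R = mat (length xs) (length xs) (\<lambda>(a, b). expanded_entry T (xs ! a) (xs ! b))"
    using assms(5) unfolding is_rules_matrix_def by blast
  interpret rules_matrix T M R xs
    using xs pruned_indices by unfold_locales auto
  let ?p = "char_poly R" and ?S = "proots (char_poly R) - {#2#}"
  have carrier: "R \<in> carrier_mat (2 ^ M + 1) (2 ^ M + 1)"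
    using R_carrier by (simp add: length_xs)
  have deg: "degree ?p = 2 ^ M + 1" and "?p \<noteq> 0"
    using degree_monic_char_poly[OF carrier] by auto
  have two: "2 \<in># proots ?p"
    using eigenvalue_2 eigenvalue_root_char_poly[OF carrier] \<open>?p \<noteq> 0\<close> by simp
  then have size: "size ?S = 2 ^ M"
    using deg by (simp add: size_Diff_singleton size_proots_complex)
  \<comment> \<open>The claimed formula serves as witness; the value \<open>undefined\<close> at 0
    makes it extensional on \<open>{1..}\<close>.\<close>
  define w where "w n = (if n \<ge> 1 then 2 ^ (n - 1) - 1 / 2 * (\<Sum>\<eta>\<in>#?S. \<eta> ^ n) else undefined)"
    for n :: nat
  \<comment> \<open>Doubling turns \<open>2 ^ (n - 1)\<close> into the power sum of the single root
    2, so that \<open>rec_sum_proots\<close> applies to both terms.\<close>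
  have w_double: "2 * w n = (\<Sum>\<eta>\<in>#{#2#}. \<eta> ^ n) - (\<Sum>\<eta>\<in>#?S. \<eta> ^ n)" if "n \<ge> 1" for n
  proof -
    have "2 * (a - 1 / 2 * s) = 2 * a - s" for a s :: complex by (simp add: field_simps)
    with that have "2 * w n = 2 * 2 ^ (n - 1) - (\<Sum>\<eta>\<in>#?S. \<eta> ^ n)"
      by (simp only: w_def if_True)
    also have "2 * 2 ^ (n - 1) = (\<Sum>\<eta>\<in>#{#2 :: complex#}. \<eta> ^ n)"
      using that by (cases n) simp_all
    finally show ?thesis .
  qed
  \<comment> \<open>Holds already from \<open>n = 1\<close>, because the trace formula does.\<close>
  have w_weight: "w n = of_nat (hamming_weight n (rot_quad T n))" if "n \<ge> 1" for n
  proof -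
    have "(\<Sum>\<eta>\<in>#proots ?p. \<eta> ^ n) = 2 ^ n + (\<Sum>\<eta>\<in>#?S. \<eta> ^ n)"
      using two by (metis image_mset_add_mset insert_DiffM sum_mset.add_mset)
    with sum_proots_power[OF that] w_double[OF that] show ?thesis by simp
  qed
  have w_rec: "(\<Sum>k = 0..2 ^ M + 1. coeff ?p k * w (n + k)) = 0" if "n \<ge> 1" for n
  proof -
    have "2 * (\<Sum>k = 0..2 ^ M + 1. coeff ?p k * w (n + k)) =
        (\<Sum>k = 0..2 ^ M + 1. coeff ?p k * (2 * w (n + k)))"
      by (simp only: sum_distrib_left mult.left_commute)
    also have "\<dots> = (\<Sum>k = 0..2 ^ M + 1. coeff ?p k * (\<Sum>\<eta>\<in>#{#2#}. \<eta> ^ (n + k))) -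
        (\<Sum>k = 0..2 ^ M + 1. coeff ?p k * (\<Sum>\<eta>\<in>#?S. \<eta> ^ (n + k)))"
      using that unfolding sum_subtractf[symmetric] right_diff_distrib[symmetric]
      by (intro sum.cong refl) (simp only: w_double trans_le_add1)
    also have "\<dots> = 0"
    proof -
      have root: "poly ?p \<eta> = 0" if "\<eta> \<in># proots ?p" for \<eta>
        using that \<open>?p \<noteq> 0\<close> by simp
      have "poly ?p \<eta> = 0" if "\<eta> \<in># {#2#}" for \<eta>
        using that root[OF two] by simp
      moreover have "poly ?p \<eta> = 0" if "\<eta> \<in># ?S" for \<eta>
        using root in_diffD[OF that] .
      ultimately show ?thesis
        by (simp only: rec_sum_proots[OF _ deg] diff_self)
    qed
    finally show ?thesis by (metis mult_eq_0_iff zero_neq_numeral)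
  qed
  have ext_w: "extends_weights T M R w"
    unfolding extends_weights_def
  proof (intro conjI allI impI)
    show "w \<in> {1..} \<rightarrow>\<^sub>E UNIV" by (intro PiE_I) (simp_all add: w_def)
  qed (use w_rec w_weight in auto)
  have unique: "v = w" if "extends_weights T M R v" for v
  proof
    fix n
    show "v n = w n"
    proof (cases "n \<ge> 1")
      case True
      have rec: "\<forall>n\<ge>1. (\<Sum>k = 0..2 ^ M + 1. coeff ?p k * v (n + k)) = 0"
        and weight: "\<forall>n\<ge>2 * M + 1. v n = of_nat (hamming_weight n (rot_quad T n))"
        using that unfolding extends_weights_def by blast+
      show ?thesis
      \<comment> \<open>Agreement from \<open>2 * M + 1\<close> on is carried down to 1 by the
        nonzero constant coefficient.\<close>
      proof (rule recurrence_backwards_unique[OF coeff_0_nonzero _ w_rec _ True])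
        show "(\<Sum>k = 0..2 ^ M + 1. coeff ?p k * v (m + k)) = 0" if "m \<ge> 1" for m
          using rec that by blast
        show "v m = w m" if "m \<ge> 2 * M + 1" for m
          using weight w_weight[of m] that by simp
      qed
    next
      case False
      moreover have "v \<in> {1..} \<rightarrow>\<^sub>E UNIV" using that by (simp add: extends_weights_def)
      ultimately show ?thesis using PiE_arb[of v "{1..}" "\<lambda>_. UNIV" n] by (simp add: w_def)
    qed
  qed
  have "\<exists>!w. extends_weights T M R w" using ext_w unique by blast
  moreover have "\<forall>v. extends_weights T M R v \<longrightarrow>
      (\<forall>n\<ge>1. v n = 2 ^ (n - 1) - 1 / 2 * (\<Sum>\<eta>\<in>#?S. \<eta> ^ n))"
  proof (intro allI impI)
    fix v and n :: nat assume "extends_weights T M R v" "1 \<le> n"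
    then show "v n = 2 ^ (n - 1) - 1 / 2 * (\<Sum>\<eta>\<in>#?S. \<eta> ^ n)"
      unfolding unique[OF \<open>extends_weights T M R v\<close>] by (simp only: w_def if_True)
  qed
  ultimately show ?thesis using carrier two size by blast
qed

end
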